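(* Every matroid based valuation is an $\mathrm{R}^{\natural}$-minor function that is monotone, real-valued (never $-\infty$) and takes the value $0$ on the empty set. That is, matroid based valuations form a subclass of the $\mathrm{R}^{\natural}$-minor functions with these properties.
   Context: All ground sets are finite; a maximum over the empty set is $-\infty$. Valuated generalized matroid: a function $f\colon 2^V\to\mathbb{R}\cup\{-\infty\}$ such that (a) for all $X,Y\subseteq V$ with $|X|<|Y|$: $f(X)+f(Y)\le\max_{j\in Y\setminus X}\{f(X+j)+f(Y-j)\}$; and (b) for all $X,Y\subseteq V$ with $|X|=|Y|$ and all $i\in X\setminus Y$: $f(X)+f(Y)\le\max_{j\in Y\setminus X}\{f(X-i+j)+f(Y+i-j)\}$. A generalized matroid on $U$ is a family $\mathcal{I}\subseteq 2^U$ of the form $\{I: g(I)=0\}$ for a valuated generalized matroid $g$ on $U$ with values in $\{0,-\infty\}$. Monotone means $f(X)\le f(Y)$ whenever $X\subseteq Y$. $\mathrm{R}^{\natural}$-minor function: $f\colon 2^V\to\mathbb{R}\cup\{-\infty\}$ is $\mathrm{R}^{\natural}$-minor if there exist a finite set $W$ disjoint from $V$, a bipartite graph $G=(V\cup W,U;E)$ with weights $c\in\mathbb{R}^E$, and a generalized matroid $\mathcal{I}$ on $U$, such that for all $X\subseteq V$, $f(X)$ is the maximum weight of a matching of $G$ whose set of endpoints in $V\cup W$ is exactly $X\cup W$ and whose set of endpoints in $U$ belongs to $\mathcal{I}$ ($-\infty$ if there is none). Matroid based valuations: a weighted matroid rank function on $V$ is $r^w(X)=\max\{\sum_{i\in I}w_i: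 I\subseteq X,\ I\in\mathcal{I}\}$ with $\mathcal{I}$ the family of independent sets of a matroid on $V$ and $w\in\mathbb{R}_{\ge0}^V$. The merge of $f,g$ on $2^V$ is $(f*g)(X)=\max\{f(Y)+g(X\setminus Y):Y\subseteq X\}$. The endowment of $f$ by $T\subseteq V$ is the function $\Delta_T(f)$ on $2^{V\setminus T}$ with $\Delta_T(f)(X)=f(X\cup T)-f(T)$. Matroid based valuations are the functions obtained from weighted matroid rank functions by arbitrary (finite) repeated application of merge and endowment. *)

theory Defs
  imports "HOL-Library.Extended_Real"
begin

text \<open>
  A function \<open>2\<^sup>V \<rightarrow> \<real> \<union> {-\<infinity>}\<close> is a function \<open>f :: 'a set \<Rightarrow> ereal\<close> together with its finite
  ground set \<open>V\<close>; only its values on subsets of \<open>V\<close> are meaningful.  Maxima of finite families are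
  suprema in \<^typ>\<open>ereal\<close>, so that the maximum of the empty family is \<open>-\<infinity>\<close>.
\<close>

definition valuated_gen_matroid :: "'a set \<Rightarrow> ('a set \<Rightarrow> ereal) \<Rightarrow> bool" where
  "valuated_gen_matroid V f \<longleftrightarrow>
     finite V \<and>
     (\<forall>X\<subseteq>V. f X \<noteq> \<infinity>) \<and>
     (\<forall>X\<subseteq>V. \<forall>Y\<subseteq>V. card X < card Y \<longrightarrow>
        f X + f Y \<le> (SUP j\<in>Y - X. f (insert j X) + f (Y - {j}))) \<and>
     (\<forall>X\<subseteq>V. \<forall>Y\<subseteq>V. card X = card Y \<longrightarrow> (\<forall>i\<in>X - Y.
        f X + f Y \<le> (SUP j\<in>Y - X. f (insert j (X - {i})) + f (insert i Y - {j}))))"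

definition gen_matroid :: "'a set \<Rightarrow> 'a set set \<Rightarrow> bool" where
  "gen_matroid U \<I> \<longleftrightarrow>
     (\<exists>g. valuated_gen_matroid U g \<and> (\<forall>X\<subseteq>U. g X \<in> {0, -\<infinity>}) \<and> \<I> = {I. I \<subseteq> U \<and> g I = 0})"

text \<open>Bipartite graphs are given by their edges, written as pairs (left endpoint, right endpoint).\<close>

definition bip_matching :: "('l \<times> 'r) set \<Rightarrow> ('l \<times> 'r) set \<Rightarrow> bool" where
  "bip_matching E M \<longleftrightarrow>
     M \<subseteq> E \<and> (\<forall>e\<in>M. \<forall>e'\<in>M. e \<noteq> e' \<longrightarrow> fst e \<noteq> fst e' \<and> snd e \<noteq> snd e')"

text \<open>
  \<open>W\<close> and \<open>U\<close> range over finite sets of natural numbers, which up to relabelling are all finite sets.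
  The sum \<open>V <+> W\<close> is the union of \<open>V\<close> with a disjoint copy of \<open>W\<close>; a set \<open>X \<union> W\<close> of endpoints
  is accordingly \<open>X <+> W\<close>.
\<close>

definition Rnat_minor :: "'a set \<Rightarrow> ('a set \<Rightarrow> ereal) \<Rightarrow> bool" where
  "Rnat_minor V f \<longleftrightarrow>
     finite V \<and>
     (\<exists>(W :: nat set) (U :: nat set) E (c :: ('a + nat) \<times> nat \<Rightarrow> real) \<I>.
        finite W \<and> finite U \<and> E \<subseteq> (V <+> W) \<times> U \<and> gen_matroid U \<I> \<and>
        (\<forall>X\<subseteq>V. f X =
           (SUP M\<in>{M. bip_matching E M \<and> fst ` M = X <+> W \<and> snd ` M \<in> \<I>}.
              ereal (\<Sum>e\<in>M. c e))))"

definition matroid :: "'a set \<Rightarrow> 'a set set \<Rightarrow> bool" where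
  "matroid V \<I> \<longleftrightarrow>
     finite V \<and> \<I> \<subseteq> Pow V \<and> {} \<in> \<I> \<and>
     (\<forall>I\<in>\<I>. \<forall>J\<subseteq>I. J \<in> \<I>) \<and>
     (\<forall>I\<in>\<I>. \<forall>J\<in>\<I>. card I < card J \<longrightarrow> (\<exists>j\<in>J - I. insert j I \<in> \<I>))"

definition weighted_rank :: "'a set set \<Rightarrow> ('a \<Rightarrow> real) \<Rightarrow> 'a set \<Rightarrow> ereal" where
  "weighted_rank \<I> w X = (SUP I\<in>{I. I \<subseteq> X \<and> I \<in> \<I>}. ereal (\<Sum>i\<in>I. w i))"

definition merge :: "('a set \<Rightarrow> ereal) \<Rightarrow> ('a set \<Rightarrow> ereal) \<Rightarrow> 'a set \<Rightarrow> ereal" where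
  "merge f g X = (SUP Y\<in>Pow X. f Y + g (X - Y))"

definition endowment :: "'a set \<Rightarrow> ('a set \<Rightarrow> ereal) \<Rightarrow> 'a set \<Rightarrow> ereal" where
  "endowment T f X = f (X \<union> T) - f T"

text \<open>
  The rule \<open>cong\<close> only identifies functions that agree as functions on \<open>2\<^sup>V\<close>.
\<close>

inductive matroid_based_valuation :: "'a set \<Rightarrow> ('a set \<Rightarrow> ereal) \<Rightarrow> bool" where
  rank: "matroid V \<I> \<Longrightarrow> (\<And>i. i \<in> V \<Longrightarrow> 0 \<le> w i)
    \<Longrightarrow> matroid_based_valuation V (weighted_rank \<I> w)"
| merge: "matroid_based_valuation V f \<Longrightarrow> matroid_based_valuation V g
    \<Longrightarrow> matroid_based_valuation V (merge f g)"
| endow: "matroid_based_valuation V f \<Longrightarrow> T \<subseteq> V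
    \<Longrightarrow> matroid_based_valuation (V - T) (endowment T f)"
| cong: "matroid_based_valuation V f \<Longrightarrow> (\<And>X. X \<subseteq> V \<Longrightarrow> g X = f X)
    \<Longrightarrow> matroid_based_valuation V g"

end

theory Submission imports Defs begin

text \<open>
  Monotonicity, finiteness and the value \<open>0\<close> at the empty set are inherited through merge and
  endowment by a direct induction.  For the representation by matchings, the induction is run with a
  hypothesis stronger than being an \<open>R\<^sup>\<natural>\<close>-minor function: the generalized matroid on the right
  side is required to be the family of independent sets of a matroid (\<open>matroid_minor\<close>).  Merging needs
  direct sums of these families, and for matroids the augmentation axiom passes to a direct sum at
  once, because \<open>|I\<^sub>1| + |I\<^sub>2| < |J\<^sub>1| + |J\<^sub>2|\<close> forces a strict inequality in one summand; the exchange
  axioms of a generalized matroid do not split in this way.  Only at the very end is a matroid turned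
  into a generalized matroid, by symmetric exchange for independent sets of equal size.

  The operations act on the bipartite graph as follows.
  \<^item> Merge: both graphs are placed side by side and their copies of \<open>V\<close> are identified.  A
    matching covering \<open>X\<close> splits into its two halves, which cover \<open>Y\<close> and \<open>X - Y\<close> for some
    \<open>Y \<subseteq> X\<close> (\<open>match_value_union\<close>).
  \<^item> Endowment by \<open>T\<close>: the vertices in \<open>T\<close> become vertices that must be matched, and the constant
    \<open>f T\<close> is subtracted from the weight of every edge at one vertex \<open>t \<in> T\<close>.  Exactly one of these
    edges is used by each admissible matching (\<open>match_value_shift\<close>).
  \<^item> Weighted rank: \<open>r\<^sup>w\<close> is the merge of the function that is \<open>w(X)\<close> on independent sets and
    \<open>-\<infinity>\<close> elsewhere with the zero function.  Both have the form \<open>w(X)\<close> restricted to the independent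
    sets of a matroid, and these are represented by a graph that is itself a perfect matching.

  The graphs are built on the vertex types that suit each construction and moved back to the natural numbers by relabelling
  vertices (\<open>match_value_relabel\<close>, \<open>matroid_minorI\<close>).
\<close>

section \<open>Exchange in matroids\<close>

lemma matroid_finite: "matroid V \<I> \<Longrightarrow> finite V"
  unfolding matroid_def by (elim conjE)

lemma matroid_subset: "matroid V \<I> \<Longrightarrow> I \<in> \<I> \<Longrightarrow> I \<subseteq> V"
  unfolding matroid_def by auto

lemma matroid_empty: "matroid V \<I> \<Longrightarrow> {} \<in> \<I>"
  unfolding matroid_def by (elim conjE)

lemma matroid_hereditary: "matroid V \<I> \<Longrightarrow> I \<in> \<I> \<Longrightarrow> J \<subseteq> I \<Longrightarrow> J \<in> \<I>"
  unfolding matroid_def by (elim conjE) (drule (1) bspec, drule spec, erule (1) mp)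

lemma matroid_augment:
  "matroid V \<I> \<Longrightarrow> I \<in> \<I> \<Longrightarrow> J \<in> \<I> \<Longrightarrow> card I < card J \<Longrightarrow> \<exists>j\<in>J - I. insert j I \<in> \<I>"
  unfolding matroid_def by (elim conjE) (drule (1) bspec, drule (1) bspec, erule (1) mp)

lemma matroid_extend:
  assumes m: "matroid V \<I>" and A: "A \<in> \<I>" and B: "B \<in> \<I>" and le: "card A \<le> card B"
  obtains Z where "Z \<in> \<I>" "A \<subseteq> Z" "Z \<subseteq> A \<union> B" "card Z = card B"
proof -
  have "\<exists>Z\<in>\<I>. A \<subseteq> Z \<and> Z \<subseteq> A \<union> B \<and> card Z = card A + k" if "card A + k \<le> card B" for k
    using that
  proof (induction k)
    case 0
    then show ?case using A by auto
  next
    case (Suc k)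
    then obtain Z where Z: "Z \<in> \<I>" "A \<subseteq> Z" "Z \<subseteq> A \<union> B" "card Z = card A + k"
      by auto
    with Suc.prems have "card Z < card B" by simp
    with matroid_augment[OF m Z(1) B] obtain j where j: "j \<in> B - Z" "insert j Z \<in> \<I>"
      by blast
    have "finite Z" using matroid_subset[OF m Z(1)] matroid_finite[OF m] by (rule finite_subset)
    with j have "card (insert j Z) = card A + Suc k" using Z(4) by simp
    then show ?case using j Z by (intro bexI[of _ "insert j Z"]) auto
  qed
  from this[of "card B - card A"] show ?thesis using le that by auto
qed

text \<open>
  Let \<open>D\<close> be \<open>Y\<close> without the elements \<open>j \<in> Y - X\<close> that may replace \<open>i\<close> in \<open>X\<close>.  No element of \<open>D - X\<close>
  can be added to \<open>X - i\<close>, so \<open>X - i\<close> has maximum size among the independent subsets of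
  \<open>(X - i) \<union> D\<close>.  Growing \<open>D\<close> inside that union to this size and augmenting once more from \<open>X\<close> must
  therefore add \<open>i\<close>; hence \<open>D + i\<close> is independent.  Growing \<open>D + i\<close> inside \<open>Y + i\<close> to the size of
  \<open>Y\<close> leaves out a single element, which lies outside \<open>D\<close> and thus is the desired \<open>j\<close>.  The argument
  takes the place of the usual one with fundamental circuits.
\<close>

lemma matroid_symmetric_exchange:
  assumes m: "matroid V \<I>" and X: "X \<in> \<I>" and Y: "Y \<in> \<I>" and XY: "card X = card Y"
    and i: "i \<in> X - Y"
  shows "\<exists>j\<in>Y - X. insert j (X - {i}) \<in> \<I> \<and> insert i Y - {j} \<in> \<I>"
proof -
  note hered = matroid_hereditary[OF m] and aug = matroid_augment[OF m]
  have fin: "finite I" if "I \<in> \<I>" for I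
    using matroid_subset[OF m that] matroid_finite[OF m] by (rule finite_subset)
  let ?X = "X - {i}"
  have Xi: "?X \<in> \<I>" using hered[OF X] by auto
  have finX: "finite X" and finY: "finite Y" using fin X Y by auto
  have cX: "card X = Suc (card ?X)" using i finX by (metis DiffD1 card_Suc_Diff1)
  define D where "D = {j \<in> Y. insert j ?X \<notin> \<I> \<or> j \<in> X}"
  have D: "D \<in> \<I>" using hered[OF Y] unfolding D_def by auto
  \<comment> \<open>Otherwise \<open>A\<close> would augment \<open>X - i\<close> by an element of \<open>D - X\<close>, which the choice of \<open>D\<close> forbids.\<close>
  have maximal: "card A \<le> card ?X" if A: "A \<in> \<I>" "A \<subseteq> ?X \<union> D" for A
  proof (rule ccontr)
    assume "\<not> card A \<le> card ?X"
    then obtain j where "j \<in> A - ?X" "insert j ?X \<in> \<I>" using aug[OF Xi A(1)] by auto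
    with A(2) i show False unfolding D_def by auto
  qed
  have "insert i D \<in> \<I>"
  proof -
    have "card D \<le> card ?X" using maximal[OF D] by auto
    then obtain B where B: "B \<in> \<I>" "D \<subseteq> B" "B \<subseteq> D \<union> ?X" "card B = card ?X"
      using matroid_extend[OF m D Xi] by metis
    then obtain x where x: "x \<in> X - B" "insert x B \<in> \<I>"
      using aug[OF B(1) X] cX by auto
    have "x = i"
    proof (rule ccontr)
      assume "x \<noteq> i"
      then have "card (insert x B) \<le> card ?X" using x B(3) by (intro maximal) auto
      then show False using x B fin[OF B(1)] by simp
    qed
    then show ?thesis using hered[OF x(2)] insert_mono[OF B(2)] by simp
  qed
  moreover have "card (insert i D) \<le> card Y"
  proof -
    obtain j where j: "j \<in> Y - ?X" "insert j ?X \<in> \<I>" using aug[OF Xi Y] cX XY by auto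
    then have "D \<subset> Y" using i unfolding D_def by auto
    then have "card D < card Y" using finY by (simp add: psubset_card_mono)
    then show ?thesis using card_insert_le_m1[of "card Y" D i] by simp
  qed
  ultimately obtain Z where Z: "Z \<in> \<I>" "insert i D \<subseteq> Z" "Z \<subseteq> insert i D \<union> Y" "card Z = card Y"
    using matroid_extend[OF m _ Y] by metis
  have ZY: "Z \<subseteq> insert i Y" using Z(3) unfolding D_def by auto
  have "Z \<noteq> insert i Y" using Z(4) i finY by auto
  then obtain j where j: "j \<in> insert i Y" "j \<notin> Z" using ZY by auto
  \<comment> \<open>Cardinalities leave no room for omitting a second element.\<close>
  have "Z = insert i Y - {j}"
  proof (rule card_subset_eq)
    show "card Z = card (insert i Y - {j})" using j(1) i finY Z(4) by (simp add: card_Diff_singleton)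
  qed (use finY ZY j in auto)
  moreover have "j \<in> Y" "j \<notin> D" using j Z(2) by auto
  ultimately show ?thesis using Z(1) unfolding D_def by auto
qed

text \<open>
  For sets of different sizes the exchange inequality is augmentation together with heredity; for sets
  of equal size it is symmetric exchange.
\<close>

lemma matroid_gen_matroid:
  assumes m: "matroid U \<I>"
  shows "gen_matroid U \<I>"
proof -
  define g :: "'a set \<Rightarrow> ereal" where "g = (\<lambda>I. if I \<in> \<I> then 0 else - \<infinity>)"
  note hered = matroid_hereditary[OF m] and aug = matroid_augment[OF m]
  have out: "g X + g Y \<le> z" if "\<not> (X \<in> \<I> \<and> Y \<in> \<I>)" for X Y z
    using that unfolding g_def by auto
  have "valuated_gen_matroid U g"
    unfolding valuated_gen_matroid_def
  proof (intro conjI allI impI ballI)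
    show "finite U" by (rule matroid_finite[OF m])
    show "g X \<noteq> \<infinity>" for X unfolding g_def by simp
  next
    fix X Y :: "'a set" assume lt: "card X < card Y"
    show "g X + g Y \<le> (SUP j\<in>Y - X. g (insert j X) + g (Y - {j}))"
    proof (cases "X \<in> \<I> \<and> Y \<in> \<I>")
      case True
      then obtain j where j: "j \<in> Y - X" "insert j X \<in> \<I>" using aug lt by blast
      have "Y - {j} \<in> \<I>" using True hered[of Y "Y - {j}"] by auto
      then show ?thesis using True j by (intro SUP_upper2[OF j(1)]) (simp add: g_def)
    qed (rule out)
  next
    fix X Y :: "'a set" and i assume eq: "card X = card Y" and i: "i \<in> X - Y"
    show "g X + g Y \<le> (SUP j\<in>Y - X. g (insert j (X - {i})) + g (insert i Y - {j}))"
    proof (cases "X \<in> \<I> \<and> Y \<in> \<I>")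
      case True
      then obtain j where j: "j \<in> Y - X" "insert j (X - {i}) \<in> \<I>" "insert i Y - {j} \<in> \<I>"
        using matroid_symmetric_exchange[OF m _ _ eq i] by blast
      then show ?thesis using True by (intro SUP_upper2[OF j(1)]) (simp add: g_def)
    qed (rule out)
  qed
  moreover have "\<I> = {I. I \<subseteq> U \<and> g I = 0}" using matroid_subset[OF m] unfolding g_def by auto
  moreover have "\<forall>X\<subseteq>U. g X \<in> {0, - \<infinity>}" unfolding g_def by simp
  ultimately show ?thesis unfolding gen_matroid_def by blast
qed

lemma matroid_image:
  assumes m: "matroid U \<I>" and inj: "inj_on h U"
  shows "matroid (h ` U) ((`) h ` \<I>)"
proof -
  note sub = matroid_subset[OF m] and hered = matroid_hereditary[OF m] and aug = matroid_augment[OF m]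
    and e = matroid_empty[OF m] and f = matroid_finite[OF m]
  have cards: "card (h ` I) = card I" if "I \<in> \<I>" for I
    using inj sub[OF that] by (intro card_image) (rule inj_on_subset)
  show ?thesis unfolding matroid_def
  proof (intro conjI ballI allI impI)
    show "finite (h ` U)" using f by simp
    show "(`) h ` \<I> \<subseteq> Pow (h ` U)" using sub by auto
    show "{} \<in> (`) h ` \<I>" using e by auto
  next
    fix I J assume "I \<in> (`) h ` \<I>" "J \<subseteq> I"
    then obtain I' where "I' \<in> \<I>" "J \<subseteq> h ` I'" by auto
    then show "J \<in> (`) h ` \<I>" by (metis hered image_eqI subset_imageE)
  next
    fix I J assume "I \<in> (`) h ` \<I>" "J \<in> (`) h ` \<I>" and lt: "card I < card J"
    then obtain I' J' where IJ: "I' \<in> \<I>" "J' \<in> \<I>" "I = h ` I'" "J = h ` J'" by auto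
    then obtain j where j: "j \<in> J' - I'" "insert j I' \<in> \<I>" using aug lt cards by metis
    have "j \<in> U" using j(1) sub[OF IJ(2)] by auto
    then have "h j \<in> J - I"
      using j(1) inj_on_image_mem_iff[OF inj _ sub[OF IJ(1)]] unfolding IJ(3,4) by simp
    moreover have "insert (h j) I \<in> (`) h ` \<I>" using IJ(3) j(2) by (metis image_eqI image_insert)
    ultimately show "\<exists>j\<in>J - I. insert j I \<in> (`) h ` \<I>" by blast
  qed
qed

lemma matroid_Pow:
  assumes V: "finite V"
  shows "matroid V (Pow V)"
proof -
  have "\<exists>j\<in>J - I. insert j I \<subseteq> V" if "I \<subseteq> V" "J \<subseteq> V" "card I < card J" for I J
  proof -
    have "\<not> J \<subseteq> I" using that V by (meson card_mono finite_subset leD)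
    then show ?thesis using that by auto
  qed
  then show ?thesis using V unfolding matroid_def by auto
qed

definition direct_sum :: "'u set set \<Rightarrow> 'u set set \<Rightarrow> 'u set set" where
  "direct_sum \<I> \<J> = {I \<union> J | I J. I \<in> \<I> \<and> J \<in> \<J>}"

lemma matroid_direct_sum:
  assumes m1: "matroid U1 \<I>" and m2: "matroid U2 \<J>" and disj: "U1 \<inter> U2 = {}"
  shows "matroid (U1 \<union> U2) (direct_sum \<I> \<J>)"
proof -
  note sub = matroid_subset[OF m1] matroid_subset[OF m2]
    and fin = matroid_finite[OF m1] matroid_finite[OF m2]
    and empty = matroid_empty[OF m1] matroid_empty[OF m2]
    and hered1 = matroid_hereditary[OF m1] and hered2 = matroid_hereditary[OF m2]
    and aug1 = matroid_augment[OF m1] and aug2 = matroid_augment[OF m2]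
  have card: "card (I \<union> J) = card I + card J" if IJ: "I \<in> \<I>" "J \<in> \<J>" for I J
  proof (rule card_Un_disjoint)
    show "finite I" using sub(1)[OF IJ(1)] fin(1) by (rule finite_subset)
    show "finite J" using sub(2)[OF IJ(2)] fin(2) by (rule finite_subset)
    show "I \<inter> J = {}" using sub(1)[OF IJ(1)] sub(2)[OF IJ(2)] disj by auto
  qed
  show ?thesis unfolding matroid_def
  proof (intro conjI ballI allI impI)
    show "finite (U1 \<union> U2)" using fin by simp
    show "direct_sum \<I> \<J> \<subseteq> Pow (U1 \<union> U2)" using sub unfolding direct_sum_def by auto
    show "{} \<in> direct_sum \<I> \<J>" using empty unfolding direct_sum_def by blast
  next
    fix A B assume "A \<in> direct_sum \<I> \<J>" "B \<subseteq> A"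
    then obtain I J where IJ: "I \<in> \<I>" "J \<in> \<J>" "B \<subseteq> I \<union> J" unfolding direct_sum_def by blast
    have "B = (B \<inter> I) \<union> (B \<inter> J)" using IJ(3) by blast
    moreover have "B \<inter> I \<in> \<I>" using hered1[OF IJ(1)] by simp
    moreover have "B \<inter> J \<in> \<J>" using hered2[OF IJ(2)] by simp
    ultimately show "B \<in> direct_sum \<I> \<J>" unfolding direct_sum_def by blast
  next
    fix A B assume "A \<in> direct_sum \<I> \<J>" "B \<in> direct_sum \<I> \<J>" and lt: "card A < card B"
    then obtain I J I' J' where A: "I \<in> \<I>" "J \<in> \<J>" "A = I \<union> J" and B: "I' \<in> \<I>" "J' \<in> \<J>" "B = I' \<union> J'"
      unfolding direct_sum_def by blast
    note subs = sub(1)[OF A(1)] sub(1)[OF B(1)] sub(2)[OF A(2)] sub(2)[OF B(2)]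
    have "card I < card I' \<or> card J < card J'" using lt unfolding A(3) B(3) card[OF A(1,2)] card[OF B(1,2)] by linarith
    then show "\<exists>j\<in>B - A. insert j A \<in> direct_sum \<I> \<J>"
    proof
      assume "card I < card I'"
      then obtain j where j: "j \<in> I' - I" "insert j I \<in> \<I>" using aug1 A B by blast
      then have "j \<in> B - A" using subs A(3) B(3) disj by blast
      moreover have "insert j A = insert j I \<union> J" using A by simp
      ultimately show ?thesis using j A unfolding direct_sum_def by blast
    next
      assume "card J < card J'"
      then obtain j where j: "j \<in> J' - J" "insert j J \<in> \<J>" using aug2 A B by blast
      then have "j \<in> B - A" using subs A(3) B(3) disj by blast
      moreover have "insert j A = I \<union> insert j J" using A by simp
      ultimately show ?thesis using j A unfolding direct_sum_def by blast
    qed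
  qed
qed

section \<open>Maximum weight matchings with prescribed left endpoints\<close>

text \<open>
  The left vertices are of an arbitrary type here, so that gluing and relabelling of graphs can be
  treated without distinguishing the ground set \<open>V\<close> from the vertices in \<open>W\<close>.
\<close>

definition match_value ::
  "('l \<times> 'r) set \<Rightarrow> ('l \<times> 'r \<Rightarrow> real) \<Rightarrow> 'r set set \<Rightarrow> 'l set \<Rightarrow> ereal" where
  "match_value E c \<I> S =
     (SUP M\<in>{M. bip_matching E M \<and> fst ` M = S \<and> snd ` M \<in> \<I>}. ereal (\<Sum>e\<in>M. c e))"

lemma match_value_upper:
  assumes "bip_matching E M" "fst ` M = S" "snd ` M \<in> \<I>"
  shows "ereal (\<Sum>e\<in>M. c e) \<le> match_value E c \<I> S"
  unfolding match_value_def using assms by (intro SUP_upper) simp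

lemma match_value_attained:
  assumes "finite E"
  obtains "match_value E c \<I> S = - \<infinity>"
  | M where "bip_matching E M" "fst ` M = S" "snd ` M \<in> \<I>"
      "match_value E c \<I> S = ereal (\<Sum>e\<in>M. c e)"
proof -
  let ?\<M> = "{M. bip_matching E M \<and> fst ` M = S \<and> snd ` M \<in> \<I>}"
  let ?w = "\<lambda>M. ereal (\<Sum>e\<in>M. c e)"
  have fin: "finite ?\<M>"
    by (rule finite_subset[of _ "Pow E"]) (use assms in \<open>auto simp: bip_matching_def\<close>)
  show ?thesis
  proof (cases "?\<M> = {}")
    case True
    then have "match_value E c \<I> S = - \<infinity>" unfolding match_value_def by (simp only:) (simp add: bot_ereal_def)
    then show ?thesis by (rule that(1))
  next
    case False
    then have "Sup (?w ` ?\<M>) = Max (?w ` ?\<M>)" using fin by (intro Max_Sup[symmetric]) auto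
    also have "\<dots> \<in> ?w ` ?\<M>" using fin False by (intro Max_in) auto
    finally show ?thesis using that(2) unfolding match_value_def by auto
  qed
qed

lemma match_value_relabel:
  assumes E: "E \<subseteq> L \<times> U" and I: "\<I> \<subseteq> Pow U" and S: "S \<subseteq> L"
    and inj: "inj_on p L" "inj_on q U"
    and c: "\<And>e. e \<in> E \<Longrightarrow> c' (map_prod p q e) = c e"
  shows "match_value (map_prod p q ` E) c' ((`) q ` \<I>) (p ` S) = match_value E c \<I> S"
proof -
  let ?F = "map_prod p q"
  have injF: "inj_on ?F E"
    using map_prod_inj_on[OF inj] E by (rule inj_on_subset)
  have iff: "bip_matching (?F ` E) (?F ` M) \<and> fst ` ?F ` M = p ` S \<and> snd ` ?F ` M \<in> (`) q ` \<I>
      \<longleftrightarrow> bip_matching E M \<and> fst ` M = S \<and> snd ` M \<in> \<I>"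
    and weight: "(\<Sum>e\<in>?F ` M. c' e) = (\<Sum>e\<in>M. c e)" if M: "M \<subseteq> E" for M
  proof -
    have sub: "fst ` M \<subseteq> L" "snd ` M \<subseteq> U" using M E by auto
    have "p (fst e) = p (fst e') \<longleftrightarrow> fst e = fst e'" "q (snd e) = q (snd e') \<longleftrightarrow> snd e = snd e'"
      "?F e = ?F e' \<longleftrightarrow> e = e'"
      if "e \<in> M" "e' \<in> M" for e e'
    proof -
      have "fst e \<in> L" "fst e' \<in> L" "snd e \<in> U" "snd e' \<in> U" using that sub by auto
      then show "p (fst e) = p (fst e') \<longleftrightarrow> fst e = fst e'" "q (snd e) = q (snd e') \<longleftrightarrow> snd e = snd e'"
        using inj by (simp_all add: inj_on_eq_iff)
      show "?F e = ?F e' \<longleftrightarrow> e = e'" using that M injF by (meson inj_on_eq_iff subsetD)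
    qed
    then have "bip_matching (?F ` E) (?F ` M) \<longleftrightarrow> bip_matching E M"
      unfolding bip_matching_def using M by auto
    moreover have "fst ` ?F ` M = p ` S \<longleftrightarrow> fst ` M = S"
      using inj_on_image_eq_iff[OF inj(1) sub(1) S] by (simp add: image_image)
    moreover have "snd ` ?F ` M \<in> (`) q ` \<I> \<longleftrightarrow> snd ` M \<in> \<I>"
    proof -
      have "snd ` ?F ` M = q ` snd ` M" by (simp add: image_image)
      moreover have "q ` snd ` M = q ` I \<longleftrightarrow> snd ` M = I" if "I \<in> \<I>" for I
      proof (rule inj_on_image_eq_iff[OF inj(2) sub(2)])
        show "I \<subseteq> U" using that I by blast
      qed
      ultimately show ?thesis unfolding image_iff by metis
    qed
    ultimately show "bip_matching (?F ` E) (?F ` M) \<and> fst ` ?F ` M = p ` S \<and> snd ` ?F ` M \<in> (`) q ` \<I>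
      \<longleftrightarrow> bip_matching E M \<and> fst ` M = S \<and> snd ` M \<in> \<I>" by simp
    show "(\<Sum>e\<in>?F ` M. c' e) = (\<Sum>e\<in>M. c e)"
    proof (subst sum.reindex)
      show "inj_on ?F M" using injF M by (rule inj_on_subset)
      show "sum (c' \<circ> ?F) M = (\<Sum>e\<in>M. c e)" using M c by (intro sum.cong) (simp_all add: c subsetD[OF M])
    qed
  qed
  have "{M. bip_matching (?F ` E) M \<and> fst ` M = p ` S \<and> snd ` M \<in> (`) q ` \<I>}
      = (`) ?F ` {M. bip_matching E M \<and> fst ` M = S \<and> snd ` M \<in> \<I>}" (is "?L = ?R")
  proof
    show "?L \<subseteq> ?R"
    proof
      fix N assume N: "N \<in> ?L"
      then obtain M where M: "M \<subseteq> E" "N = ?F ` M" unfolding bip_matching_def by (auto elim: subset_imageE)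
      have "M \<in> {M. bip_matching E M \<and> fst ` M = S \<and> snd ` M \<in> \<I>}"
        using N unfolding M(2) mem_Collect_eq iff[OF M(1)] .
      then show "N \<in> ?R" unfolding M(2) by (rule imageI)
    qed
    show "?R \<subseteq> ?L"
    proof (rule image_subsetI)
      fix M assume M: "M \<in> {M. bip_matching E M \<and> fst ` M = S \<and> snd ` M \<in> \<I>}"
      then have "M \<subseteq> E" unfolding bip_matching_def by simp
      then show "?F ` M \<in> ?L" using M unfolding mem_Collect_eq by (subst iff)
    qed
  qed
  then show ?thesis
    unfolding match_value_def
    by (auto simp: image_image weight bip_matching_def intro!: SUP_cong)
qed

text \<open>
  A matching of the union of two graphs with disjoint right sides is a pair of matchings with disjoint
  sets of left endpoints.  The left sides may overlap, and it is the distribution of the overlap that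
  will produce the maximum in a merge.  Since the maxima on the right are attained unless they are
  \<open>-\<infinity>\<close>, optimal halves can be put together.
\<close>

lemma match_value_union:
  assumes E1: "E1 \<subseteq> L1 \<times> U1" and E2: "E2 \<subseteq> L2 \<times> U2" and disj: "U1 \<inter> U2 = {}"
    and I: "\<I> \<subseteq> Pow U1" "\<J> \<subseteq> Pow U2" and fin: "finite E1" "finite E2"
  shows "match_value (E1 \<union> E2) c (direct_sum \<I> \<J>) S =
    (SUP (A, B)\<in>{(A, B). A \<union> B = S \<and> A \<inter> B = {} \<and> A \<subseteq> L1 \<and> B \<subseteq> L2}.
       match_value E1 c \<I> A + match_value E2 c \<J> B)" (is "?l = ?r")
proof (rule antisym)
  show "?l \<le> ?r" unfolding match_value_def[of "E1 \<union> E2"]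
  proof (rule SUP_least)
    fix M assume "M \<in> {M. bip_matching (E1 \<union> E2) M \<and> fst ` M = S \<and> snd ` M \<in> direct_sum \<I> \<J>}"
    then obtain I J where M: "bip_matching (E1 \<union> E2) M" "fst ` M = S"
      and IJ: "I \<in> \<I>" "J \<in> \<J>" "snd ` M = I \<union> J"
      unfolding direct_sum_def by auto
    define M1 where "M1 = M \<inter> E1"
    define M2 where "M2 = M \<inter> E2"
    have split: "M = M1 \<union> M2" "M1 \<inter> M2 = {}"
      using M(1) E1 E2 disj unfolding M1_def M2_def bip_matching_def by (auto 0 3)
    have m12: "bip_matching E1 M1" "bip_matching E2 M2"
      using M(1) unfolding M1_def M2_def bip_matching_def by blast+
    have d: "fst ` M1 \<inter> fst ` M2 = {}"
    proof -
      have "fst e \<noteq> fst e'" if e: "e \<in> M1" "e' \<in> M2" for e e'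
      proof -
        have "e \<in> M" "e' \<in> M" "e \<noteq> e'" using e split by auto
        then show ?thesis using M(1) unfolding bip_matching_def by simp
      qed
      then show ?thesis by blast
    qed
    have sides: "snd ` M1 \<subseteq> U1" "snd ` M2 \<subseteq> U2" "fst ` M1 \<subseteq> L1" "fst ` M2 \<subseteq> L2"
    proof -
      have "M1 \<subseteq> L1 \<times> U1" using E1 unfolding M1_def by (rule le_infI2)
      then show "snd ` M1 \<subseteq> U1" "fst ` M1 \<subseteq> L1" by auto
      have "M2 \<subseteq> L2 \<times> U2" using E2 unfolding M2_def by (rule le_infI2)
      then show "snd ` M2 \<subseteq> U2" "fst ` M2 \<subseteq> L2" by auto
    qed
    have IJsub: "I \<subseteq> U1" "J \<subseteq> U2" using IJ I by auto
    have eq: "snd ` M1 \<union> snd ` M2 = I \<union> J" using IJ(3) split(1) by (simp add: image_Un)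
    have "snd ` M1 = I" "snd ` M2 = J"
      using eq sides(1,2) IJsub disj by blast+
    then have le: "ereal (\<Sum>e\<in>M1. c e) \<le> match_value E1 c \<I> (fst ` M1)"
      "ereal (\<Sum>e\<in>M2. c e) \<le> match_value E2 c \<J> (fst ` M2)"
      using m12 IJ by (auto intro: match_value_upper)
    have "finite M1" "finite M2" unfolding M1_def M2_def using fin by auto
    then have "ereal (\<Sum>e\<in>M. c e) = ereal (\<Sum>e\<in>M1. c e) + ereal (\<Sum>e\<in>M2. c e)"
      using split by (simp add: sum.union_disjoint)
    also have "\<dots> \<le> match_value E1 c \<I> (fst ` M1) + match_value E2 c \<J> (fst ` M2)"
      by (rule add_mono[OF le])
    also have "\<dots> \<le> ?r"
      by (rule SUP_upper2[of "(fst ` M1, fst ` M2)"])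
        (use sides d split(1) M(2) in \<open>auto simp: image_Un\<close>)
    finally show "ereal (\<Sum>e\<in>M. c e) \<le> ?r" .
  qed
next
  have "match_value E1 c \<I> A + match_value E2 c \<J> B \<le> ?l"
    if AB: "A \<union> B = S" "A \<inter> B = {}" for A B
  proof (rule match_value_attained[OF fin(1), of c \<I> A];
      rule match_value_attained[OF fin(2), of c \<J> B])
    fix M1 M2
    assume M1: "bip_matching E1 M1" "fst ` M1 = A" "snd ` M1 \<in> \<I>"
      "match_value E1 c \<I> A = ereal (\<Sum>e\<in>M1. c e)"
    assume M2: "bip_matching E2 M2" "fst ` M2 = B" "snd ` M2 \<in> \<J>"
      "match_value E2 c \<J> B = ereal (\<Sum>e\<in>M2. c e)"
    have sub: "M1 \<subseteq> E1" "M2 \<subseteq> E2" using M1 M2 unfolding bip_matching_def by auto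
    have cross: "fst e \<noteq> fst e'" "snd e \<noteq> snd e'" if "e \<in> M1" "e' \<in> M2" for e e'
    proof -
      show "fst e \<noteq> fst e'" using that M1(2) M2(2) AB(2) by blast
      have "snd e \<in> U1" "snd e' \<in> U2" using that sub E1 E2 by auto
      then show "snd e \<noteq> snd e'" using disj by auto
    qed
    have bip: "bip_matching (E1 \<union> E2) (M1 \<union> M2)"
    proof -
      have sep: "fst e \<noteq> fst e' \<and> snd e \<noteq> snd e'" if "e \<in> M1 \<union> M2" "e' \<in> M1 \<union> M2" "e \<noteq> e'" for e e'
        using that(1,2)
      proof (elim UnE)
        assume "e \<in> M1" "e' \<in> M1"
        then show ?thesis using M1(1) that(3) unfolding bip_matching_def by simp
      next
        assume "e \<in> M2" "e' \<in> M2"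
        then show ?thesis using M2(1) that(3) unfolding bip_matching_def by simp
      next
        assume "e \<in> M1" "e' \<in> M2"
        then show ?thesis using cross[of e e'] by simp
      next
        assume "e \<in> M2" "e' \<in> M1"
        then show ?thesis using cross[of e' e] by simp
      qed
      have "M1 \<union> M2 \<subseteq> E1 \<union> E2" using sub by (rule Un_mono)
      then show ?thesis unfolding bip_matching_def using sep by simp
    qed
    have "snd ` (M1 \<union> M2) \<in> direct_sum \<I> \<J>"
      unfolding direct_sum_def using M1(3) M2(3) by (auto simp: image_Un)
    then have "ereal (\<Sum>e\<in>M1 \<union> M2. c e) \<le> ?l"
      using M1(2) M2(2) AB(1) by (intro match_value_upper bip) auto
    moreover have "(\<Sum>e\<in>M1 \<union> M2. c e) = (\<Sum>e\<in>M1. c e) + (\<Sum>e\<in>M2. c e)"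
      using cross fin sub by (intro sum.union_disjoint) (auto intro: finite_subset)
    ultimately show ?thesis using M1(4) M2(4) by simp
  qed simp_all
  then show "?r \<le> ?l" by (auto intro!: SUP_least)
qed

text \<open>
  A matching that covers \<open>t\<close> uses exactly one edge at \<open>t\<close>.  The reverse inequality follows by
  shifting back by \<open>- k\<close>.
\<close>

lemma match_value_shift_le:
  assumes t: "t \<in> S" and fin: "finite E"
  shows "match_value E (\<lambda>e. c e + (if fst e = t then k else 0)) \<I> S \<le> match_value E c \<I> S + ereal k"
  unfolding match_value_def[of E "\<lambda>e. c e + (if fst e = t then k else 0)"]
proof (rule SUP_least)
  fix M assume "M \<in> {M. bip_matching E M \<and> fst ` M = S \<and> snd ` M \<in> \<I>}"
  then have M: "bip_matching E M" "fst ` M = S" "snd ` M \<in> \<I>" by auto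
  then obtain e where e: "e \<in> M" "fst e = t" using t by auto
  have finM: "finite M" using M(1) fin unfolding bip_matching_def by (auto intro: finite_subset)
  have "fst x = t \<longleftrightarrow> x = e" if "x \<in> M" for x
    using M(1) e that unfolding bip_matching_def by (elim conjE) metis
  then have "(\<Sum>x\<in>M. if fst x = t then k else 0) = (\<Sum>x\<in>M. if x = e then k else 0)"
    using e by (intro sum.cong) auto
  also have "\<dots> = k" using finM e by simp
  finally have "ereal (\<Sum>x\<in>M. c x + (if fst x = t then k else 0)) = ereal (\<Sum>x\<in>M. c x) + ereal k"
    by (simp add: sum.distrib)
  also have "\<dots> \<le> match_value E c \<I> S + ereal k"
    by (intro add_right_mono match_value_upper M)
  finally show "ereal (\<Sum>x\<in>M. c x + (if fst x = t then k else 0)) \<le> match_value E c \<I> S + ereal k" .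
qed

lemma match_value_shift:
  assumes t: "t \<in> S" and fin: "finite E"
  shows "match_value E (\<lambda>e. c e + (if fst e = t then k else 0)) \<I> S = match_value E c \<I> S + ereal k"
    (is "match_value E ?c \<I> S = _")
proof (rule antisym)
  have "(\<lambda>e. ?c e + (if fst e = t then - k else 0)) = c" by auto
  then have "match_value E c \<I> S \<le> match_value E ?c \<I> S + ereal (- k)"
    using match_value_shift_le[OF assms, of ?c "- k" \<I>] by simp
  then show "match_value E c \<I> S + ereal k \<le> match_value E ?c \<I> S"
    by (cases "match_value E c \<I> S"; cases "match_value E ?c \<I> S") auto
qed (rule match_value_shift_le[OF assms])

section \<open>Minors of matroids\<close>

text \<open>
  The induction hypothesis of the main proof: an \<open>R\<^sup>\<natural>\<close>-minor representation in which the
  generalized matroid consists of the independent sets of a matroid.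
\<close>

definition matroid_minor :: "'a set \<Rightarrow> ('a set \<Rightarrow> ereal) \<Rightarrow> bool" where
  "matroid_minor V f \<longleftrightarrow>
     finite V \<and>
     (\<exists>(W :: nat set) (U :: nat set) E c \<I>.
        finite W \<and> E \<subseteq> (V <+> W) \<times> U \<and> matroid U \<I> \<and>
        (\<forall>X\<subseteq>V. f X = match_value E c \<I> (X <+> W)))"

lemma matroid_minor_imp_Rnat_minor:
  assumes "matroid_minor V f"
  shows "Rnat_minor V f"
proof -
  obtain W U :: "nat set" and E c \<I> where *: "finite W" "E \<subseteq> (V <+> W) \<times> U" "matroid U \<I>"
    "\<forall>X\<subseteq>V. f X = match_value E c \<I> (X <+> W)" and V: "finite V"
    using assms unfolding matroid_minor_def by (elim conjE exE)
  show ?thesis unfolding Rnat_minor_def match_value_def[symmetric]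
    using V * matroid_finite[OF *(3)] matroid_gen_matroid[OF *(3)] by blast
qed

text \<open>
  The vertices of a representing graph may be taken from any types, since finite sets embed into the
  natural numbers.
\<close>

lemma matroid_minorI:
  fixes W :: "'w set" and U :: "'u set"
  assumes V: "finite V" and W: "finite W" and m: "matroid U \<I>" and E: "E \<subseteq> (V <+> W) \<times> U"
    and f: "\<And>X. X \<subseteq> V \<Longrightarrow> f X = match_value E c \<I> (X <+> W)"
  shows "matroid_minor V f"
proof -
  have U: "finite U" and I: "\<I> \<subseteq> Pow U" using m unfolding matroid_def by auto
  obtain h :: "'w \<Rightarrow> nat" where h: "inj_on h W" using W finite_imp_inj_to_nat_seg by metis
  obtain q :: "'u \<Rightarrow> nat" where q: "inj_on q U" using U finite_imp_inj_to_nat_seg by metis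
  let ?p = "map_sum id h :: 'a + 'w \<Rightarrow> _"
  let ?F = "map_prod ?p q"
  have p: "inj_on ?p (V <+> W)"
    using h by (intro inj_onI) (auto elim!: PlusE dest: inj_onD)
  have F: "inj_on ?F E" using map_prod_inj_on[OF p q] E by (rule inj_on_subset)
  have img: "?p ` (X <+> W) = X <+> h ` W" for X
    by (auto simp: Plus_def image_Un image_image)
  have "f X = match_value (?F ` E) (c \<circ> the_inv_into E ?F) ((`) q ` \<I>) (X <+> h ` W)"
    if "X \<subseteq> V" for X
  proof -
    have "match_value (?F ` E) (c \<circ> the_inv_into E ?F) ((`) q ` \<I>) (?p ` (X <+> W))
        = match_value E c \<I> (X <+> W)"
      using that by (intro match_value_relabel[OF E I _ p q]) (auto simp: the_inv_into_f_f[OF F])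
    then show ?thesis using f[OF that] img by simp
  qed
  moreover have "?F ` E \<subseteq> (V <+> h ` W) \<times> q ` U" using E img[of V] by fastforce
  moreover have "matroid (q ` U) ((`) q ` \<I>)" by (rule matroid_image[OF m q])
  ultimately show ?thesis unfolding matroid_minor_def using V W by blast
qed

lemma matroid_minor_merge:
  assumes "matroid_minor V f" "matroid_minor V g"
  shows "matroid_minor V (merge f g)"
proof -
  obtain W1 U1 :: "nat set" and E1 c1 \<I> where 1: "finite W1" "E1 \<subseteq> (V <+> W1) \<times> U1" "matroid U1 \<I>"
    "\<And>X. X \<subseteq> V \<Longrightarrow> f X = match_value E1 c1 \<I> (X <+> W1)" and V: "finite V"
    using assms(1) unfolding matroid_minor_def by metis
  obtain W2 U2 :: "nat set" and E2 c2 \<J> where 2: "finite W2" "E2 \<subseteq> (V <+> W2) \<times> U2" "matroid U2 \<J>"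
    "\<And>X. X \<subseteq> V \<Longrightarrow> g X = match_value E2 c2 \<J> (X <+> W2)"
    using assms(2) unfolding matroid_minor_def by metis
  have finU: "finite U1" "finite U2" and I: "\<I> \<subseteq> Pow U1" "\<J> \<subseteq> Pow U2"
    using 1(3) 2(3) unfolding matroid_def by auto
  have finE: "finite E1" "finite E2"
    using V 1(1) 2(1) finU 1(2) 2(2) by (meson finite_Plus finite_SigmaI finite_subset)+
  let ?p1 = "map_sum id Inl :: 'a + nat \<Rightarrow> 'a + (nat + nat)"
  let ?p2 = "map_sum id Inr :: 'a + nat \<Rightarrow> 'a + (nat + nat)"
  let ?F1 = "map_prod ?p1 (Inl :: nat \<Rightarrow> nat + nat)"
  let ?F2 = "map_prod ?p2 (Inr :: nat \<Rightarrow> nat + nat)"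
  have p: "inj ?p1" "inj ?p2" by (auto intro: sum.inj_map)
  \<comment> \<open>The two summands of the right side tell from which graph an edge comes.\<close>
  define unlabel :: "'a + (nat + nat) \<Rightarrow> 'a + nat" where
    "unlabel = map_sum id (case_sum id id)"
  define c :: "('a + (nat + nat)) \<times> (nat + nat) \<Rightarrow> real" where
    "c = (\<lambda>(l, r). case r of Inl u \<Rightarrow> c1 (unlabel l, u) | Inr u \<Rightarrow> c2 (unlabel l, u))"
  have unlabel: "unlabel (?p1 l) = l" "unlabel (?p2 l) = l" for l
    by (cases l; simp add: unlabel_def)+
  let ?L1 = "V <+> Inl ` W1 :: ('a + (nat + nat)) set"
  let ?L2 = "V <+> Inr ` W2 :: ('a + (nat + nat)) set"
  have img: "?p1 ` (X <+> W1) = X <+> Inl ` W1" "?p2 ` (X <+> W2) = X <+> Inr ` W2" for X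
    by (auto simp: Plus_def image_Un image_image)
  have E: "?F1 ` E1 \<subseteq> ?L1 \<times> Inl ` U1" "?F2 ` E2 \<subseteq> ?L2 \<times> Inr ` U2"
    using 1(2) 2(2) img[of V] by fastforce+
  have f: "match_value (?F1 ` E1) c ((`) Inl ` \<I>) (X <+> Inl ` W1) = f X"
    and g: "match_value (?F2 ` E2) c ((`) Inr ` \<J>) (X <+> Inr ` W2) = g X" if "X \<subseteq> V" for X
  proof -
    have sub: "X <+> W1 \<subseteq> V <+> W1" "X <+> W2 \<subseteq> V <+> W2" using that by auto
    have "match_value (?F1 ` E1) c ((`) Inl ` \<I>) (?p1 ` (X <+> W1)) = match_value E1 c1 \<I> (X <+> W1)"
      by (rule match_value_relabel[OF 1(2) I(1) sub(1)])
        (auto simp: c_def unlabel intro: inj_on_subset[OF p(1)])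
    then show "match_value (?F1 ` E1) c ((`) Inl ` \<I>) (X <+> Inl ` W1) = f X"
      using 1(4)[OF that] img by simp
    have "match_value (?F2 ` E2) c ((`) Inr ` \<J>) (?p2 ` (X <+> W2)) = match_value E2 c2 \<J> (X <+> W2)"
      by (rule match_value_relabel[OF 2(2) I(2) sub(2)])
        (auto simp: c_def unlabel intro: inj_on_subset[OF p(2)])
    then show "match_value (?F2 ` E2) c ((`) Inr ` \<J>) (X <+> Inr ` W2) = g X"
      using 2(4)[OF that] img by simp
  qed
  show ?thesis
  proof (rule matroid_minorI[OF V])
    show "finite (W1 <+> W2)" using 1(1) 2(1) by simp
    show "matroid (Inl ` U1 \<union> Inr ` U2) (direct_sum ((`) Inl ` \<I>) ((`) Inr ` \<J>))"
      by (intro matroid_direct_sum matroid_image 1 2) auto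
    show "?F1 ` E1 \<union> ?F2 ` E2 \<subseteq> (V <+> (W1 <+> W2)) \<times> (Inl ` U1 \<union> Inr ` U2)"
      using E by (auto simp: Plus_def)
    fix X assume X: "X \<subseteq> V"
    let ?split = "\<lambda>Y. (Y <+> Inl ` W1, (X - Y) <+> Inr ` W2)"
    \<comment> \<open>A vertex of \<open>W1\<close> or \<open>W2\<close> is on the left side of only one of the graphs, so only \<open>X\<close> is split freely.\<close>
    have pairs: "{(A, B). A \<union> B = X <+> (W1 <+> W2) \<and> A \<inter> B = {} \<and> A \<subseteq> ?L1 \<and> B \<subseteq> ?L2}
        = ?split ` Pow X" (is "?P = _")
    proof
      show "?split ` Pow X \<subseteq> ?P" using X by (auto simp: Plus_def)
      show "?P \<subseteq> ?split ` Pow X"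
      proof clarify
        fix A B
        assume AB: "A \<union> B = X <+> (W1 <+> W2)" "A \<inter> B = {}" "A \<subseteq> ?L1" "B \<subseteq> ?L2"
        have x: "Inl v \<in> A \<union> B \<longleftrightarrow> v \<in> X" for v unfolding AB(1) by auto
        have b: "Inl v \<in> B \<longleftrightarrow> v \<in> X \<and> Inl v \<notin> A" for v using x[of v] AB(2) by blast
        have w: "Inr (Inl a) \<in> A \<longleftrightarrow> a \<in> W1" "Inr (Inr a) \<in> B \<longleftrightarrow> a \<in> W2"
          "Inr (Inr a) \<notin> A" "Inr (Inl a) \<notin> B" for a
        proof -
          show o: "Inr (Inr a) \<notin> A" "Inr (Inl a) \<notin> B" using AB(3,4) by auto
          have "Inr (Inl a) \<in> A \<union> B \<longleftrightarrow> a \<in> W1" "Inr (Inr a) \<in> A \<union> B \<longleftrightarrow> a \<in> W2"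
            unfolding AB(1) by auto
          then show "Inr (Inl a) \<in> A \<longleftrightarrow> a \<in> W1" "Inr (Inr a) \<in> B \<longleftrightarrow> a \<in> W2"
            using o by auto
        qed
        have "A = Inl -` A <+> Inl ` W1"
        proof (rule set_eqI)
          fix z show "z \<in> A \<longleftrightarrow> z \<in> Inl -` A <+> Inl ` W1"
            using w by (cases z; cases "projr z") auto
        qed
        moreover have "B = (X - Inl -` A) <+> Inr ` W2"
        proof (rule set_eqI)
          fix z show "z \<in> B \<longleftrightarrow> z \<in> (X - Inl -` A) <+> Inr ` W2"
            using w b by (cases z; cases "projr z") auto
        qed
        moreover have "Inl -` A \<subseteq> X" using x by auto
        ultimately show "(A, B) \<in> ?split ` Pow X" by blast
      qed
    qed
    have "match_value (?F1 ` E1 \<union> ?F2 ` E2) c (direct_sum ((`) Inl ` \<I>) ((`) Inr ` \<J>)) (X <+> (W1 <+> W2))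
      = (SUP (A, B)\<in>?split ` Pow X. match_value (?F1 ` E1) c ((`) Inl ` \<I>) A
           + match_value (?F2 ` E2) c ((`) Inr ` \<J>) B)"
      unfolding pairs[symmetric]
    proof (rule match_value_union[OF E])
      show "(`) Inl ` \<I> \<subseteq> Pow (Inl ` U1)" "(`) Inr ` \<J> \<subseteq> Pow (Inr ` U2)" using I by blast+
    qed (use finE in auto)
    also have "\<dots> = (SUP Y\<in>Pow X. f Y + g (X - Y))"
      unfolding image_image
    proof (rule SUP_cong[OF refl])
      fix Y assume "Y \<in> Pow X"
      then have "Y \<subseteq> V" "X - Y \<subseteq> V" using X by auto
      then show "(case ?split Y of (A, B) \<Rightarrow> match_value (?F1 ` E1) c ((`) Inl ` \<I>) A
          + match_value (?F2 ` E2) c ((`) Inr ` \<J>) B) = f Y + g (X - Y)"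
        by (simp add: f g)
    qed
    finally show "merge f g X = match_value (?F1 ` E1 \<union> ?F2 ` E2) c
        (direct_sum ((`) Inl ` \<I>) ((`) Inr ` \<J>)) (X <+> (W1 <+> W2))"
      unfolding merge_def by simp
  qed
qed

lemma matroid_minor_endowment:
  assumes f: "matroid_minor V f" and T: "T \<subseteq> V" "t \<in> T" and fT: "f T = ereal k"
  shows "matroid_minor (V - T) (endowment T f)"
proof -
  obtain W U :: "nat set" and E c \<I> where 1: "finite W" "E \<subseteq> (V <+> W) \<times> U" "matroid U \<I>"
    "\<And>X. X \<subseteq> V \<Longrightarrow> f X = match_value E c \<I> (X <+> W)" and V: "finite V"
    using f unfolding matroid_minor_def by metis
  have U: "finite U" and I: "\<I> \<subseteq> Pow U" using 1(3) unfolding matroid_def by auto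
  have finE: "finite E"
    using V 1(1) U 1(2) by (meson finite_Plus finite_SigmaI finite_subset)
  define p :: "'a + nat \<Rightarrow> 'a + (nat + 'a)" where
    "p = case_sum (\<lambda>v. if v \<in> T then Inr (Inr v) else Inl v) (\<lambda>w. Inr (Inl w))"
  let ?F = "map_prod p id :: _ \<times> nat \<Rightarrow> _"
  have p: "inj p" unfolding inj_def p_def by (auto split: sum.splits if_splits)
  have F: "inj_on ?F E" using map_prod_inj_on[OF p inj_on_id[of UNIV]] by (rule inj_on_subset) simp
  have img: "p ` ((X \<union> T) <+> W) = X <+> (W <+> T)" if "X \<inter> T = {}" for X
    using that unfolding p_def Plus_def by (force simp: image_Un image_image)
  define c' where "c' = c \<circ> the_inv_into E ?F"
  show ?thesis
  proof (rule matroid_minorI)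
    show "finite (V - T)" "finite (W <+> T)" using V 1(1) T(1) by (auto intro: finite_subset)
    show "matroid U \<I>" by fact
    have "(V - T) \<union> T = V" using T by auto
    then have "p ` (V <+> W) = (V - T) <+> (W <+> T)" using img[of "V - T"] by auto
    then show "?F ` E \<subseteq> ((V - T) <+> (W <+> T)) \<times> U"
      using image_mono[OF 1(2), of ?F] by (simp add: map_prod_surj_on[OF _ refl])
    fix X assume X: "X \<subseteq> V - T"
    then have XT: "X \<union> T \<subseteq> V" "X \<inter> T = {}" using T by auto
    have "match_value (?F ` E) (\<lambda>e. c' e + (if fst e = Inr (Inr t) then - k else 0)) \<I> (X <+> (W <+> T))
        = match_value (?F ` E) c' \<I> (X <+> (W <+> T)) + ereal (- k)"
      using T finE by (intro match_value_shift) auto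
    also have "match_value (?F ` E) c' \<I> (X <+> (W <+> T)) = f (X \<union> T)"
    proof -
      have "match_value (?F ` E) c' ((`) id ` \<I>) (p ` ((X \<union> T) <+> W)) = match_value E c \<I> ((X \<union> T) <+> W)"
        using XT by (intro match_value_relabel[OF 1(2) I])
          (auto simp: c'_def the_inv_into_f_f[OF F] intro: inj_on_subset[OF p])
      then show ?thesis using 1(4)[OF XT(1)] img[OF XT(2)] by simp
    qed
    finally show "endowment T f X = match_value (?F ` E)
        (\<lambda>e. c' e + (if fst e = Inr (Inr t) then - k else 0)) \<I> (X <+> (W <+> T))"
      unfolding endowment_def fT minus_ereal_def uminus_ereal.simps by (rule sym)
  qed
qed

lemma matroid_minor_independent_weight:
  assumes m: "matroid V \<I>"
  shows "matroid_minor V (\<lambda>X. if X \<in> \<I> then ereal (\<Sum>i\<in>X. w i) else - \<infinity>)"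
proof (rule matroid_minorI[where W = "{} :: nat set"])
  let ?E = "(\<lambda>v. (Inl v, v)) ` V :: (('a + nat) \<times> 'a) set"
  show "finite V" using m unfolding matroid_def by simp
  show "matroid V \<I>" by fact
  show "?E \<subseteq> (V <+> {}) \<times> V" by auto
  fix X assume X: "X \<subseteq> V"
  let ?M = "(\<lambda>v. (Inl v, v)) ` X :: (('a + nat) \<times> 'a) set"
  have "M = ?M" if M: "M \<subseteq> ?E" "fst ` M = X <+> {}" for M
  proof
    show "M \<subseteq> ?M"
    proof
      fix e assume e: "e \<in> M"
      then obtain v where v: "e = (Inl v, v)" using M(1) by blast
      then have "Inl v \<in> X <+> ({} :: nat set)" using e M(2) by force
      then show "e \<in> ?M" using v by auto
    qed
    show "?M \<subseteq> M"
    proof clarify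
      fix v assume "v \<in> X"
      then have "Inl v \<in> fst ` M" using M(2) by auto
      then obtain u where "(Inl v, u) \<in> M" by force
      then show "(Inl v, v) \<in> M" using M(1) by blast
    qed
  qed
  then have unique: "M = ?M" if "bip_matching ?E M" "fst ` M = X <+> {}" for M
    using that unfolding bip_matching_def by (elim conjE)
  have M: "bip_matching ?E ?M" using X unfolding bip_matching_def by auto
  have ends: "fst ` ?M = X <+> {}" "snd ` ?M = X" by (force simp: Plus_def image_image)+
  have "{M. bip_matching ?E M \<and> fst ` M = X <+> {} \<and> snd ` M \<in> \<I>}
      = (if X \<in> \<I> then {?M} else {})" (is "?\<M> = ?R")
  proof
    show "?\<M> \<subseteq> ?R"
    proof
      fix M assume "M \<in> ?\<M>"
      then have "M = ?M" "snd ` M \<in> \<I>" using unique by simp_all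
      then show "M \<in> ?R" using ends(2) by simp
    qed
    show "?R \<subseteq> ?\<M>" using M ends by simp
  qed
  moreover have "(\<Sum>e\<in>?M. w (snd e)) = (\<Sum>i\<in>X. w i)"
    by (subst sum.reindex) (auto simp: inj_on_def)
  ultimately show "(if X \<in> \<I> then ereal (\<Sum>i\<in>X. w i) else - \<infinity>)
      = match_value ?E (\<lambda>e. w (snd e)) \<I> (X <+> {})"
    unfolding match_value_def by (simp add: bot_ereal_def)
qed simp

text \<open>
  The maximum over independent \<open>I \<subseteq> X\<close> is a maximum over splittings of \<open>X\<close> into \<open>I\<close> and a part of
  value \<open>0\<close>.  The zero function is written as the weight function of the free matroid with zero
  weights, so that both parts are covered by the same representation.
\<close>

lemma weighted_rank_eq_merge:
  assumes X: "X \<subseteq> V"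
  shows "weighted_rank \<I> w X =
    merge (\<lambda>X. if X \<in> \<I> then ereal (\<Sum>i\<in>X. w i) else - \<infinity>)
      (\<lambda>X. if X \<in> Pow V then ereal (\<Sum>i\<in>X. 0) else - \<infinity>) X"
  unfolding weighted_rank_def merge_def
proof (rule antisym)
  let ?t = "\<lambda>Y. (if Y \<in> \<I> then ereal (\<Sum>i\<in>Y. w i) else - \<infinity>)
      + (if X - Y \<in> Pow V then ereal (\<Sum>i\<in>X - Y. 0) else - \<infinity>)"
  have t: "?t Y = (if Y \<in> \<I> then ereal (\<Sum>i\<in>Y. w i) else - \<infinity>)" for Y
    using X by auto
  show "(SUP I\<in>{I. I \<subseteq> X \<and> I \<in> \<I>}. ereal (\<Sum>i\<in>I. w i)) \<le> (SUP Y\<in>Pow X. ?t Y)"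
    unfolding t
  proof (rule SUP_least)
    fix I assume "I \<in> {I. I \<subseteq> X \<and> I \<in> \<I>}"
    then show "ereal (\<Sum>i\<in>I. w i) \<le> (SUP Y\<in>Pow X. if Y \<in> \<I> then ereal (\<Sum>i\<in>Y. w i) else - \<infinity>)"
      by (intro SUP_upper2[of I]) simp_all
  qed
  show "(SUP Y\<in>Pow X. ?t Y) \<le> (SUP I\<in>{I. I \<subseteq> X \<and> I \<in> \<I>}. ereal (\<Sum>i\<in>I. w i))"
    unfolding t by (rule SUP_least) (auto intro!: SUP_upper)
qed

lemma matroid_minor_cong:
  assumes "matroid_minor V f" "\<And>X. X \<subseteq> V \<Longrightarrow> g X = f X"
  shows "matroid_minor V g"
  using assms unfolding matroid_minor_def by metis

lemma matroid_minor_weighted_rank: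
  assumes m: "matroid V \<I>"
  shows "matroid_minor V (weighted_rank \<I> w)"
proof -
  from matroid_minor_merge[OF matroid_minor_independent_weight[OF m]
      matroid_minor_independent_weight[OF matroid_Pow[OF matroid_finite[OF m]]]]
  show ?thesis by (rule matroid_minor_cong) (rule weighted_rank_eq_merge)
qed

section \<open>Matroid based valuations\<close>

lemma finite_SUP_real:
  fixes f :: "'i \<Rightarrow> ereal"
  assumes "finite A" "A \<noteq> {}" "\<And>x. x \<in> A \<Longrightarrow> \<exists>r. f x = ereal r"
  shows "\<exists>r. (SUP x\<in>A. f x) = ereal r"
proof -
  have "Sup (f ` A) = Max (f ` A)" using assms by (intro Max_Sup[symmetric]) auto
  also have "\<dots> \<in> f ` A" using assms by (intro Max_in) auto
  finally show ?thesis using assms(3) by auto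
qed

theorem corollary7p11:
  fixes V :: "'a set" and f :: "'a set \<Rightarrow> ereal"
  assumes "matroid_based_valuation V f"
  shows "Rnat_minor V f \<and> mono_on (Pow V) f \<and> (\<forall>X\<subseteq>V. \<exists>r::real. f X = ereal r) \<and> f {} = 0"
proof -
  have "matroid_minor V f \<and> mono_on (Pow V) f \<and> (\<forall>X\<subseteq>V. \<exists>r::real. f X = ereal r) \<and> f {} = 0"
    using assms
  proof (induction rule: matroid_based_valuation.induct)
    case (rank V \<I> w)
    then have V: "finite V" and sub: "\<I> \<subseteq> Pow V" and e: "{} \<in> \<I>" unfolding matroid_def by auto
    have "\<exists>r. weighted_rank \<I> w X = ereal r" for X
      unfolding weighted_rank_def
    proof (rule finite_SUP_real)
      show "finite {I. I \<subseteq> X \<and> I \<in> \<I>}"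
        by (rule finite_subset[of _ "Pow V"]) (use V sub in auto)
    qed (use e in auto)
    moreover have "mono_on (Pow V) (weighted_rank \<I> w)"
      unfolding weighted_rank_def by (intro mono_onI SUP_subset_mono) auto
    moreover have "{I. I \<subseteq> {} \<and> I \<in> \<I>} = {{}}" using e by auto
    then have "weighted_rank \<I> w {} = 0" unfolding weighted_rank_def by (simp add: zero_ereal_def)
    ultimately show ?case using matroid_minor_weighted_rank[OF rank(1)] by simp
  next
    case (merge V f g)
    then have V: "finite V" unfolding matroid_minor_def by simp
    have "\<exists>r. merge f g X = ereal r" if "X \<subseteq> V" for X
      unfolding merge_def
    proof (rule finite_SUP_real)
      show "finite (Pow X)" using that V by (simp add: finite_subset)
      fix Y assume "Y \<in> Pow X"
      then obtain r s where "f Y = ereal r" "g (X - Y) = ereal s"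
        using merge.IH \<open>X \<subseteq> V\<close> by (metis Diff_subset PowD order_trans)
      then show "\<exists>r. f Y + g (X - Y) = ereal r" by simp
    qed auto
    moreover have "mono_on (Pow V) (merge f g)"
    proof (rule mono_onI)
      fix X X' assume X: "X \<in> Pow V" "X' \<in> Pow V" "X \<subseteq> X'"
      show "merge f g X \<le> merge f g X'"
        unfolding merge_def
      proof (rule SUP_least)
        fix Y assume Y: "Y \<in> Pow X"
        have "g (X - Y) \<le> g (X' - Y)" using merge.IH X by (intro mono_onD[of "Pow V" g]) auto
        then show "f Y + g (X - Y) \<le> (SUP Y\<in>Pow X'. f Y + g (X' - Y))"
          using X Y by (intro SUP_upper2[of Y]) (auto intro: add_left_mono)
      qed
    qed
    moreover have "merge f g {} = 0" using merge.IH by (simp add: merge_def)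
    ultimately show ?case using merge.IH by (simp add: matroid_minor_merge)
  next
    case (endow V f T)
    then obtain k where k: "f T = ereal k" by auto
    have real: "\<exists>r. endowment T f X = ereal r" if "X \<subseteq> V - T" for X
    proof -
      have "X \<union> T \<subseteq> V" using that endow.hyps(2) by auto
      then obtain r where "f (X \<union> T) = ereal r" using endow.IH by metis
      then show ?thesis unfolding endowment_def k by simp
    qed
    moreover have "mono_on (Pow (V - T)) (endowment T f)"
    proof (rule mono_onI)
      fix X Y assume "X \<in> Pow (V - T)" "Y \<in> Pow (V - T)" "X \<subseteq> Y"
      then have "f (X \<union> T) \<le> f (Y \<union> T)" using endow by (intro mono_onD[of "Pow V" f]) auto
      then show "endowment T f X \<le> endowment T f Y"
        unfolding endowment_def by (intro ereal_minus_mono) auto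
    qed
    moreover have "endowment T f {} = 0" by (simp add: endowment_def k zero_ereal_def)
    moreover have "matroid_minor (V - T) (endowment T f)"
    \<comment> \<open>For empty \<open>T\<close> there is no vertex to carry the constant, but then \<open>f T = 0\<close>.\<close>
    proof (cases "T = {}")
      case True
      then show ?thesis
        using endow.IH by (auto simp: endowment_def[abs_def])
    next
      case False
      then obtain t where t: "t \<in> T" by blast
      show ?thesis
        using endow.IH endow.hyps(2) t k by (intro matroid_minor_endowment[of V f T t k]) simp_all
    qed
    ultimately show ?case by blast
  next
    case (cong V f g)
    then have "matroid_minor V g" using matroid_minor_cong[of V f g] by blast
    moreover have "mono_on (Pow V) g"
    proof (rule mono_onI)
      fix X Y assume X: "X \<in> Pow V" "Y \<in> Pow V" "X \<subseteq> Y"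
      then have "f X \<le> f Y" using cong.IH by (intro mono_onD[of "Pow V" f]) auto
      then show "g X \<le> g Y" using X cong.hyps(2) by simp
    qed
    moreover have "\<forall>X\<subseteq>V. \<exists>r. g X = ereal r" using cong.IH cong.hyps(2) by metis
    moreover have "g {} = 0" using cong.IH cong.hyps(2) by simp
    ultimately show ?case by blast
  qed
  then show ?thesis using matroid_minor_imp_Rnat_minor by blast
qed

end
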